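(* Let $\mathcal{X}$ be an $N$-order tensor with all mode lengths equal to $I$ and with set of observable entries $\Omega$, let the core tensor have all mode lengths equal to $J$, and let $T$ be the number of threads used for parallelization. Then the memory complexity of the P-Tucker algorithm, i.e. the space required for its intermediate data, is $O(TJ^2)$.
   Context: Intermediate data means the memory required for updating the factor matrices, excluding the memory for storing the input tensor $\mathcal{X}$, the core tensor $\mathcal{G}$ and the factor matrices $\mathbf{A}^{(n)}$ themselves. Data: tensor $\mathcal{X}$ with observable index tuples $\Omega\subseteq\{1,\dots,I\}^N$, factor matrices $\mathbf{A}^{(n)}=(a^{(n)}_{ij})\in\mathbb{R}^{I\times J}$ ($n=1,\dots,N$), core tensor $\mathcal{G}\in\mathbb{R}^{J\times\cdots\times J}$ of order $N$, regularization parameter $\lambda>0$. $\Omega^{(n)}_{i_n}$ is the set of tuples in $\Omega$ with $n$th coordinate $i_n$. Updating factor matrices in P-Tucker: for each $n=1,\dots,N$ the rows of $\mathbf{A}^{(n)}$ are distributed over $T$ threads working in parallel; each thread processes its rows sequentially and has its own intermediate data, which is released after each row update. To update row $i_n$: for each $\alpha=(i_1,\dots,i_N)\in\Omega^{(n)}_{i_n}$, compute $\delta^{(n)}_\alpha\in\mathbb{R}^J$ by looping over all $\beta=(j_1,\dots,j_N)\in\{1,\dots,J\}^N$ and adding $\mathcal{G}_\beta\prod_{k\ne n}a^{(k)}_{i_kj_k}$ to $\delta^{(n)}_\alpha(j_n)$, and then accumulate this $\alpha$'s contribution to $\mathbf{B}^{(n)}_{i_n}\in\mathbb{R}^{J\times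 J}$, with entries $\sum_{\alpha\in\Omega^{(n)}_{i_n}}\delta^{(n)}_\alpha(j)\delta^{(n)}_\alpha(j')$, and to $\mathbf{c}^{(n)}_{i_n:}\in\mathbb{R}^J$, with entries $\sum_{\alpha\in\Omega^{(n)}_{i_n}}\mathcal{X}_\alpha\delta^{(n)}_\alpha(j)$. Then compute $[\mathbf{B}^{(n)}_{i_n}+\lambda\mathbf{I}_J]^{-1}$ and replace the $i_n$th row of $\mathbf{A}^{(n)}$ by $\mathbf{c}^{(n)}_{i_n:}[\mathbf{B}^{(n)}_{i_n}+\lambda\mathbf{I}_J]^{-1}$. *)

theory Defs
  imports Complex_Main "HOL-Library.Extended_Nat"
begin

text \<open>
  All indices are 0-based: a mode of length \<open>I\<close> is indexed by \<open>{..<I}\<close>, and the modes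
  themselves by \<open>{..<N}\<close>. Index tuples are lists of length \<open>N\<close>.
\<close>

record ptucker_data =
  tensor_order :: nat                                     \<comment> \<open>\<open>N\<close>\<close>
  mode_length :: nat                                      \<comment> \<open>\<open>I\<close>\<close>
  core_length :: nat                                      \<comment> \<open>\<open>J\<close>\<close>
  observed :: "nat list list"                             \<comment> \<open>enumeration of \<open>\<Omega>\<close>, in storage order\<close>
  tensor :: "nat list \<Rightarrow> real"                            \<comment> \<open>\<open>\<X>\<close>, relevant on \<open>\<Omega>\<close> only\<close>
  core :: "nat list \<Rightarrow> real"                              \<comment> \<open>\<open>\<G>\<close>\<close>
  init_factors :: "nat \<Rightarrow> nat \<Rightarrow> nat \<Rightarrow> real"             \<comment> \<open>\<open>A\<close> at \<open>n i j\<close>, before the update\<close>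
  regularization :: real                                  \<comment> \<open>\<open>\<lambda>\<close>\<close>

definition valid_data :: "ptucker_data \<Rightarrow> bool" where
  "valid_data D \<longleftrightarrow>
     tensor_order D > 0 \<and> mode_length D > 0 \<and> core_length D > 0 \<and> regularization D > 0 \<and>
     distinct (observed D) \<and>
     set (observed D) \<subseteq> {\<alpha>. length \<alpha> = tensor_order D \<and> set \<alpha> \<subseteq> {..<mode_length D}}"

text \<open>
  The code executed by one thread is a program of a small imperative language, whose text does
  not depend on the data. A thread owns natural-number variables (used for counters and
  indices), real variables and real arrays; each variable and each array element occupies one
  memory cell. The stored \<open>\<X>\<close>, \<open>\<G>\<close> and factor matrices are shared by all threads and are
  accessed by position.
\<close>

type_synonym vname = string

datatype nexp =
    NConst nat | NVar vname
  | NAdd nexp nexp | NMul nexp nexp | NDiv nexp nexp | NMod nexp nexp | NPow nexp nexp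
  | Order | CoreLength
  | NumObserved
  | Coord nexp nexp            \<comment> \<open>\<open>Coord p k\<close>: \<open>k\<close>th index of the \<open>p\<close>th observed tuple\<close>

datatype rexp =
    RConst real | RVar vname
  | Elem vname nexp
  | RAdd rexp rexp | RSub rexp rexp | RMul rexp rexp | RDiv rexp rexp
  | Regularization
  | TensorVal nexp             \<comment> \<open>value of \<open>\<X>\<close> at the tuple stored at the given position\<close>
  | CoreVal nexp               \<comment> \<open>value of \<open>\<G>\<close> at the given position of the dense array of size \<open>J ^ N\<close>\<close>
  | Factor nexp nexp nexp

datatype bexp = Equal nexp nexp | Less nexp nexp

datatype com =
    SKIP
  | SetN vname nexp
  | SetR vname rexp
  | Alloc vname nexp
  | SetElem vname nexp rexp
  | SetFactor nexp nexp nexp rexp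
  | Seq com com  (infixr ";;" 60)
  | Cond bexp com com
  | While bexp com

record store =
  nvars :: "vname \<rightharpoonup> nat"
  rvars :: "vname \<rightharpoonup> real"
  arrays :: "vname \<rightharpoonup> real list"

definition store_size :: "store \<Rightarrow> nat" where
  "store_size s =
     card (dom (nvars s)) + card (dom (rvars s)) +
     (\<Sum>a\<in>dom (arrays s). length (the (arrays s a)))"

type_synonym factors = "nat \<Rightarrow> nat \<Rightarrow> nat \<Rightarrow> real"

definition get :: "'a::zero option \<Rightarrow> 'a" where
  "get v = (case v of None \<Rightarrow> 0 | Some x \<Rightarrow> x)"

text \<open>\<open>\<G>\<close> is stored with the index of mode 0 varying fastest.\<close>

definition core_tuple :: "ptucker_data \<Rightarrow> nat \<Rightarrow> nat list" where
  "core_tuple D b = map (\<lambda>k. b div core_length D ^ k mod core_length D) [0..<tensor_order D]"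

primrec nval :: "ptucker_data \<Rightarrow> store \<Rightarrow> nexp \<Rightarrow> nat" where
  "nval D s (NConst m) = m"
| "nval D s (NVar x) = get (nvars s x)"
| "nval D s (NAdd e f) = nval D s e + nval D s f"
| "nval D s (NMul e f) = nval D s e * nval D s f"
| "nval D s (NDiv e f) = nval D s e div nval D s f"
| "nval D s (NMod e f) = nval D s e mod nval D s f"
| "nval D s (NPow e f) = nval D s e ^ nval D s f"
| "nval D s Order = tensor_order D"
| "nval D s CoreLength = core_length D"
| "nval D s NumObserved = length (observed D)"
| "nval D s (Coord p k) = observed D ! nval D s p ! nval D s k"

primrec rval :: "ptucker_data \<Rightarrow> factors \<Rightarrow> store \<Rightarrow> rexp \<Rightarrow> real" where
  "rval D A s (RConst r) = r"
| "rval D A s (RVar x) = get (rvars s x)"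
| "rval D A s (Elem a e) =
     (case arrays s a of None \<Rightarrow> 0
      | Some xs \<Rightarrow> if nval D s e < length xs then xs ! nval D s e else 0)"
| "rval D A s (RAdd e f) = rval D A s e + rval D A s f"
| "rval D A s (RSub e f) = rval D A s e - rval D A s f"
| "rval D A s (RMul e f) = rval D A s e * rval D A s f"
| "rval D A s (RDiv e f) = rval D A s e / rval D A s f"
| "rval D A s Regularization = regularization D"
| "rval D A s (TensorVal p) = tensor D (observed D ! nval D s p)"
| "rval D A s (CoreVal b) = core D (core_tuple D (nval D s b))"
| "rval D A s (Factor k i j) = A (nval D s k) (nval D s i) (nval D s j)"

primrec bval :: "ptucker_data \<Rightarrow> store \<Rightarrow> bexp \<Rightarrow> bool" where
  "bval D s (Equal e f) \<longleftrightarrow> nval D s e = nval D s f"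
| "bval D s (Less e f) \<longleftrightarrow> nval D s e < nval D s f"

definition write_factor :: "factors \<Rightarrow> nat \<Rightarrow> nat \<Rightarrow> nat \<Rightarrow> real \<Rightarrow> factors" where
  "write_factor A n i j r = A(n := (A n)(i := (A n i)(j := r)))"

inductive com_step ::
  "ptucker_data \<Rightarrow> com \<times> store \<times> factors \<Rightarrow> com \<times> store \<times> factors \<Rightarrow> bool" for D where
  "com_step D (SetN x e, s, A) (SKIP, s\<lparr>nvars := (nvars s)(x \<mapsto> nval D s e)\<rparr>, A)"
| "com_step D (SetR x e, s, A) (SKIP, s\<lparr>rvars := (rvars s)(x \<mapsto> rval D A s e)\<rparr>, A)"
| "com_step D (Alloc a e, s, A)
     (SKIP, s\<lparr>arrays := (arrays s)(a \<mapsto> replicate (nval D s e) 0)\<rparr>, A)"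
| "com_step D (SetElem a e f, s, A)
     (SKIP,
      s\<lparr>arrays := (arrays s)
          (a := map_option (\<lambda>xs. xs[nval D s e := rval D A s f]) (arrays s a))\<rparr>,
      A)"
| "com_step D (SetFactor k i j f, s, A)
     (SKIP, s, write_factor A (nval D s k) (nval D s i) (nval D s j) (rval D A s f))"
| "com_step D (SKIP ;; c, s, A) (c, s, A)"
| "com_step D (c, s, A) (c', s', A') \<Longrightarrow> com_step D (c ;; d, s, A) (c' ;; d, s', A')"
| "bval D s b \<Longrightarrow> com_step D (Cond b c d, s, A) (c, s, A)"
| "\<not> bval D s b \<Longrightarrow> com_step D (Cond b c d, s, A) (d, s, A)"
| "com_step D (While b c, s, A) (Cond b (c ;; While b c) SKIP, s, A)"

definition For :: "vname \<Rightarrow> nexp \<Rightarrow> com \<Rightarrow> com" where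
  "For x e c = SetN x (NConst 0) ;; While (Less (NVar x) e) (c ;; SetN x (NAdd (NVar x) (NConst 1)))"

abbreviation entry :: "vname \<Rightarrow> vname \<Rightarrow> nexp" where
  "entry r c \<equiv> NAdd (NMul (NVar r) CoreLength) (NVar c)"

text \<open>
  \<open>\<delta>\<close> for the observed tuple at position \<open>p\<close>. The loop over \<open>\<beta>\<close> runs through the positions \<open>b\<close>
  of \<open>\<G>\<close>; the components of \<open>\<beta>\<close> are the base-\<open>J\<close> digits of \<open>b\<close>, extracted one after the other,
  so that \<open>\<beta>\<close> itself is never held in local memory.
\<close>

definition compute_delta :: com where
  "compute_delta =
     For ''j'' CoreLength (SetElem ''delta'' (NVar ''j'') (RConst 0)) ;;
     For ''b'' (NPow CoreLength Order)
       (SetR ''w'' (CoreVal (NVar ''b'')) ;;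
        SetN ''q'' (NVar ''b'') ;;
        For ''k'' Order
          (Cond (Equal (NVar ''k'') (NVar ''n''))
             (SetN ''jn'' (NMod (NVar ''q'') CoreLength))
             (SetR ''w''
                (RMul (RVar ''w'')
                   (Factor (NVar ''k'') (Coord (NVar ''p'') (NVar ''k''))
                      (NMod (NVar ''q'') CoreLength)))) ;;
           SetN ''q'' (NDiv (NVar ''q'') CoreLength)) ;;
        SetElem ''delta'' (NVar ''jn'') (RAdd (Elem ''delta'' (NVar ''jn'')) (RVar ''w'')))"

definition accumulate :: com where
  "accumulate =
     For ''j'' CoreLength
       (For ''l'' CoreLength
          (SetElem ''B'' (entry ''j'' ''l'')
             (RAdd (Elem ''B'' (entry ''j'' ''l''))
                (RMul (Elem ''delta'' (NVar ''j'')) (Elem ''delta'' (NVar ''l''))))) ;;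
        SetElem ''c'' (NVar ''j'')
          (RAdd (Elem ''c'' (NVar ''j''))
             (RMul (TensorVal (NVar ''p'')) (Elem ''delta'' (NVar ''j'')))))"

definition add_regularization :: com where
  "add_regularization =
     For ''j'' CoreLength
       (SetElem ''B'' (entry ''j'' ''j'')
          (RAdd (Elem ''B'' (entry ''j'' ''j'')) Regularization))"

text \<open>
  Gauss-Jordan elimination, turning \<open>B\<close> into the identity and \<open>Inv\<close> into the inverse. No
  pivoting is needed, since it is applied to a symmetric positive definite matrix.
\<close>

definition invert :: com where
  "invert =
     For ''j'' CoreLength (SetElem ''Inv'' (entry ''j'' ''j'') (RConst 1)) ;;
     For ''k'' CoreLength
       (SetR ''w'' (Elem ''B'' (entry ''k'' ''k'')) ;;
        For ''l'' CoreLength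
          (SetElem ''B'' (entry ''k'' ''l'') (RDiv (Elem ''B'' (entry ''k'' ''l'')) (RVar ''w'')) ;;
           SetElem ''Inv'' (entry ''k'' ''l'') (RDiv (Elem ''Inv'' (entry ''k'' ''l'')) (RVar ''w''))) ;;
        For ''j'' CoreLength
          (Cond (Equal (NVar ''j'') (NVar ''k''))
             SKIP
             (SetR ''w'' (Elem ''B'' (entry ''j'' ''k'')) ;;
              For ''l'' CoreLength
                (SetElem ''B'' (entry ''j'' ''l'')
                   (RSub (Elem ''B'' (entry ''j'' ''l''))
                      (RMul (RVar ''w'') (Elem ''B'' (entry ''k'' ''l'')))) ;;
                 SetElem ''Inv'' (entry ''j'' ''l'')
                   (RSub (Elem ''Inv'' (entry ''j'' ''l''))
                      (RMul (RVar ''w'') (Elem ''Inv'' (entry ''k'' ''l''))))))))"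

definition replace_row :: com where
  "replace_row =
     For ''l'' CoreLength
       (SetR ''w'' (RConst 0) ;;
        For ''j'' CoreLength
          (SetR ''w'' (RAdd (RVar ''w'')
             (RMul (Elem ''c'' (NVar ''j'')) (Elem ''Inv'' (entry ''j'' ''l''))))) ;;
        SetFactor (NVar ''n'') (NVar ''i'') (NVar ''l'') (RVar ''w''))"

definition update_row :: com where
  "update_row =
     Alloc ''B'' (NMul CoreLength CoreLength) ;;
     Alloc ''c'' CoreLength ;;
     Alloc ''delta'' CoreLength ;;
     For ''p'' NumObserved
       (Cond (Equal (Coord (NVar ''p'') (NVar ''n'')) (NVar ''i''))
          (compute_delta ;; accumulate)
          SKIP) ;;
     add_regularization ;;
     Alloc ''Inv'' (NMul CoreLength CoreLength) ;;
     invert ;;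
     replace_row"

text \<open>
  \<open>rows n t\<close> is the list of the rows of the \<open>n\<close>th factor matrix processed by thread \<open>t\<close>, in
  this order.
\<close>

definition row_distribution :: "ptucker_data \<Rightarrow> nat \<Rightarrow> (nat \<Rightarrow> nat \<Rightarrow> nat list) \<Rightarrow> bool" where
  "row_distribution D T rows \<longleftrightarrow>
     (\<forall>n<tensor_order D.
        distinct (concat (map (rows n) [0..<T])) \<and>
        set (concat (map (rows n) [0..<T])) = {..<mode_length D})"

datatype activity = Idle | Updating com store

type_synonym thread = "nat list \<times> activity"              \<comment> \<open>rows still to be processed, activity\<close>
type_synonym config = "nat \<times> factors \<times> thread list"      \<comment> \<open>current mode, factor matrices, threads\<close>

definition idle_threads :: "nat \<Rightarrow> (nat \<Rightarrow> nat \<Rightarrow> nat list) \<Rightarrow> nat \<Rightarrow> thread list" where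
  "idle_threads T rows n = map (\<lambda>t. (rows n t, Idle)) [0..<T]"

definition initial_store :: "nat \<Rightarrow> nat \<Rightarrow> store" where
  "initial_store n i =
     \<lparr>nvars = [''n'' \<mapsto> n, ''i'' \<mapsto> i], rvars = Map.empty, arrays = Map.empty\<rparr>"

text \<open>
  The threads are interleaved arbitrarily; all of them have to finish a mode before the next one
  is started. Finishing a row releases the local memory of the thread.
\<close>

inductive ptucker_step ::
  "ptucker_data \<Rightarrow> nat \<Rightarrow> (nat \<Rightarrow> nat \<Rightarrow> nat list) \<Rightarrow> config \<Rightarrow> config \<Rightarrow> bool"
  for D T rows where
  start: "\<lbrakk>t < length ths; ths ! t = (i # is, Idle)\<rbrakk> \<Longrightarrow>
     ptucker_step D T rows (n, A, ths)
       (n, A, ths[t := (is, Updating update_row (initial_store n i))])"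
| run: "\<lbrakk>t < length ths; ths ! t = (is, Updating c s); com_step D (c, s, A) (c', s', A')\<rbrakk> \<Longrightarrow>
     ptucker_step D T rows (n, A, ths) (n, A', ths[t := (is, Updating c' s')])"
| finish: "\<lbrakk>t < length ths; ths ! t = (is, Updating SKIP s)\<rbrakk> \<Longrightarrow>
     ptucker_step D T rows (n, A, ths) (n, A, ths[t := (is, Idle)])"
| next_mode: "\<lbrakk>\<forall>th\<in>set ths. th = ([], Idle); Suc n < tensor_order D\<rbrakk> \<Longrightarrow>
     ptucker_step D T rows (n, A, ths) (Suc n, A, idle_threads T rows (Suc n))"

definition ptucker_reachable ::
  "ptucker_data \<Rightarrow> nat \<Rightarrow> (nat \<Rightarrow> nat \<Rightarrow> nat list) \<Rightarrow> config set" where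
  "ptucker_reachable D T rows =
     {cfg. (ptucker_step D T rows)\<^sup>*\<^sup>* (0, init_factors D, idle_threads T rows 0) cfg}"

fun thread_memory :: "thread \<Rightarrow> nat" where
  "thread_memory (is, Idle) = 0"
| "thread_memory (is, Updating c s) = store_size s"

fun intermediate_data :: "config \<Rightarrow> nat" where
  "intermediate_data (n, A, ths) = sum_list (map thread_memory ths)"

definition ptucker_memory ::
  "ptucker_data \<Rightarrow> nat \<Rightarrow> (nat \<Rightarrow> nat \<Rightarrow> nat list) \<Rightarrow> enat" where
  "ptucker_memory D T rows =
     (SUP cfg\<in>ptucker_reachable D T rows. enat (intermediate_data cfg))"

end

theory Submission
  imports Defs
begin

text \<open>
  The text of the row update mentions ten scalar variables and four arrays, and every allocation
  has size \<open>J\<close> or \<open>J\<^sup>2\<close>. Since a thread can only write to variables occurring in its program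
  text, its store never occupies more than \<open>10 + 4 J\<^sup>2\<close> cells, and there are \<open>T\<close> threads.
\<close>

text \<open>A check on the program text alone: \<open>X\<close>, \<open>Y\<close> and
  \<open>Z\<close> are the permitted names of natural-number variables, real variables and arrays.
  Allocation sizes are bounded in every store, so that execution need not be followed.
  \<open>SetElem\<close> is unconstrained because it neither creates nor lengthens an array.\<close>

primrec confined ::
  "ptucker_data \<Rightarrow> vname set \<Rightarrow> vname set \<Rightarrow> vname set \<Rightarrow> nat \<Rightarrow> com \<Rightarrow> bool" where
  "confined D X Y Z m SKIP \<longleftrightarrow> True"
| "confined D X Y Z m (SetN x e) \<longleftrightarrow> x \<in> X"
| "confined D X Y Z m (SetR x e) \<longleftrightarrow> x \<in> Y"
| "confined D X Y Z m (Alloc a e) \<longleftrightarrow> a \<in> Z \<and> (\<forall>s. nval D s e \<le> m)"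
| "confined D X Y Z m (SetElem a e f) \<longleftrightarrow> True"
| "confined D X Y Z m (SetFactor k i j f) \<longleftrightarrow> True"
| "confined D X Y Z m (c ;; d) \<longleftrightarrow> confined D X Y Z m c \<and> confined D X Y Z m d"
| "confined D X Y Z m (Cond b c d) \<longleftrightarrow> confined D X Y Z m c \<and> confined D X Y Z m d"
| "confined D X Y Z m (While b c) \<longleftrightarrow> confined D X Y Z m c"

definition fits :: "vname set \<Rightarrow> vname set \<Rightarrow> vname set \<Rightarrow> nat \<Rightarrow> store \<Rightarrow> bool" where
  "fits X Y Z m s \<longleftrightarrow>
     dom (nvars s) \<subseteq> X \<and> dom (rvars s) \<subseteq> Y \<and> dom (arrays s) \<subseteq> Z \<and>
     (\<forall>a xs. arrays s a = Some xs \<longrightarrow> length xs \<le> m)"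

text \<open>Residual programs are assembled from commands already present: unrolling a loop only
  copies its body inside a \<open>Cond\<close>. Hence confinement survives each step, and it limits
  what the step can add to the store.\<close>

lemma com_step_confined_fits:
  assumes "com_step D (c, s, A) (c', s', A')" "confined D X Y Z m c" "fits X Y Z m s"
  shows "confined D X Y Z m c' \<and> fits X Y Z m s'"
  using assms
  by (induction "(c, s, A)" "(c', s', A')" arbitrary: c s A c' s' A' rule: com_step.induct)
    (auto simp: fits_def split: if_splits)

lemma store_size_fits:
  assumes "fits X Y Z m s" "finite X" "finite Y" "finite Z"
  shows "store_size s \<le> card X + card Y + card Z * m"
proof -
  have "(\<Sum>a\<in>dom (arrays s). length (the (arrays s a))) \<le> card (dom (arrays s)) * m"
    using assms(1) by (intro sum_bounded_above[of _ _ m, simplified]) (auto simp: fits_def)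
  also have "\<dots> \<le> card Z * m"
    using assms by (simp add: fits_def card_mono)
  finally show ?thesis
    using assms unfolding store_size_def fits_def by (intro add_mono card_mono) auto
qed

text \<open>The remaining program is tracked along with the store, since the bound on the store
  alone is not inductive.\<close>

primrec fitting_activity ::
  "ptucker_data \<Rightarrow> vname set \<Rightarrow> vname set \<Rightarrow> vname set \<Rightarrow> nat \<Rightarrow> activity \<Rightarrow> bool" where
  "fitting_activity D X Y Z m Idle \<longleftrightarrow> True"
| "fitting_activity D X Y Z m (Updating c s) \<longleftrightarrow> confined D X Y Z m c \<and> fits X Y Z m s"

text \<open>A step alters a single thread or makes all of them idle, so the invariant can be checked
  thread by thread, whatever the interleaving. The condition on \<open>X\<close> covers the names
  bound by \<open>initial_store\<close>.\<close>

lemma ptucker_step_fitting: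
  assumes "ptucker_step D T rows (n, A, ths) (n', A', ths')"
    and "confined D X Y Z m update_row" "{''n'', ''i''} \<subseteq> X"
    and "length ths = T" "\<forall>th\<in>set ths. fitting_activity D X Y Z m (snd th)"
  shows "length ths' = T \<and> (\<forall>th\<in>set ths'. fitting_activity D X Y Z m (snd th))"
  using assms(1)
proof cases
  case (start t i "is")
  moreover have "fits X Y Z m (initial_store n i)"
    using assms(3) by (auto simp: fits_def initial_store_def)
  ultimately show ?thesis
    using assms(2,4,5) by (auto dest!: set_update_subset_insert[THEN subsetD])
next
  case (run t "is" c s c' s')
  have "fitting_activity D X Y Z m (snd (ths ! t))"
    using run assms(5) nth_mem by blast
  then have "confined D X Y Z m c' \<and> fits X Y Z m s'"
    using run com_step_confined_fits by auto
  then show ?thesis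
    using run assms(4,5) by (auto dest!: set_update_subset_insert[THEN subsetD])
next
  case (finish t "is" s)
  then show ?thesis
    using assms(4,5) by (auto dest!: set_update_subset_insert[THEN subsetD])
next
  case next_mode
  then show ?thesis by (auto simp: idle_threads_def)
qed

lemma ptucker_reachable_fitting:
  assumes "cfg \<in> ptucker_reachable D T rows"
    and "confined D X Y Z m update_row" "{''n'', ''i''} \<subseteq> X"
  shows "length (snd (snd cfg)) = T \<and>
    (\<forall>th\<in>set (snd (snd cfg)). fitting_activity D X Y Z m (snd th))"
proof -
  have "(ptucker_step D T rows)\<^sup>*\<^sup>* (0, init_factors D, idle_threads T rows 0) cfg"
    using assms(1) by (simp add: ptucker_reachable_def)
  then show ?thesis
  proof (induction rule: rtranclp_induct)
    case base
    then show ?case by (auto simp: idle_threads_def)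
  next
    case (step cfg cfg')
    then show ?case
      using ptucker_step_fitting[OF _ assms(2,3)] by (metis prod.collapse)
  qed
qed

lemma thread_memory_fitting:
  assumes "fitting_activity D X Y Z m (snd th)" "finite X" "finite Y" "finite Z"
  shows "thread_memory th \<le> card X + card Y + card Z * m"
  using assms store_size_fits by (cases th rule: thread_memory.cases) auto

text \<open>Summing the bound for one thread over \<open>T\<close> threads gives a number
  independent of the configuration, which therefore passes to the supremum.\<close>

lemma ptucker_memory_le:
  assumes "confined D X Y Z m update_row" "{''n'', ''i''} \<subseteq> X" "finite X" "finite Y" "finite Z"
  shows "ptucker_memory D T rows \<le> enat (T * (card X + card Y + card Z * m))"
  unfolding ptucker_memory_def
proof (rule SUP_least)
  fix cfg assume cfg: "cfg \<in> ptucker_reachable D T rows"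
  obtain n A ths where eq: "cfg = (n, A, ths)" by (cases cfg)
  have len: "length ths = T" and fit: "\<forall>th\<in>set ths. fitting_activity D X Y Z m (snd th)"
    using ptucker_reachable_fitting[OF cfg assms(1,2)] by (auto simp: eq)
  have "sum_list (map thread_memory ths)
      \<le> sum_list (map (\<lambda>_. card X + card Y + card Z * m) ths)"
    using fit assms(3-5) by (intro sum_list_mono thread_memory_fitting) auto
  then show "enat (intermediate_data cfg) \<le> enat (T * (card X + card Y + card Z * m))"
    by (simp add: eq len sum_list_triv)
qed

lemma confined_update_row:
  assumes "(core_length D)\<^sup>2 \<le> m"
  shows "confined D {''n'', ''i'', ''j'', ''l'', ''k'', ''b'', ''q'', ''jn'', ''p''} {''w''}
    {''B'', ''c'', ''delta'', ''Inv''} m update_row"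
proof -
  have "core_length D * core_length D \<le> m"
    using assms by (simp add: power2_eq_square)
  \<comment> \<open>This covers \<open>c\<close> and \<open>delta\<close>, the arrays of length
    \<open>J\<close>.\<close>
  moreover from this have "core_length D \<le> m"
    using le_square le_trans by blast
  ultimately show ?thesis
    by (simp add: update_row_def compute_delta_def accumulate_def add_regularization_def
        invert_def replace_row_def For_def)
qed

theorem theorem4:
  "\<exists>C::nat. \<forall>(D::ptucker_data) (T::nat) (rows::nat \<Rightarrow> nat \<Rightarrow> nat list).
     valid_data D \<and> T > 0 \<and> row_distribution D T rows \<longrightarrow>
     ptucker_memory D T rows \<le> enat (C * (T * (core_length D)\<^sup>2))"
proof (intro exI allI impI)
  fix D T rows
  assume "valid_data D \<and> T > 0 \<and> row_distribution D T rows"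
  then have J: "1 \<le> (core_length D)\<^sup>2"
    by (auto simp: valid_data_def Suc_le_eq)
  \<comment> \<open>Here 10 counts nine natural-number variables and the real variable
    \<open>w\<close>, and 4 counts the arrays; \<open>order_refl\<close> fixes \<open>m\<close> as
    \<open>J^2\<close>.\<close>
  have "ptucker_memory D T rows \<le> enat (T * (10 + 4 * (core_length D)\<^sup>2))"
    by (rule order_trans[OF ptucker_memory_le[OF confined_update_row[OF order_refl]]])
      (simp_all add: algebra_simps)
  \<comment> \<open>Since \<open>J^2\<close> is at least 1, the scalar part \<open>10 * T\<close> is
    absorbed, and 14 = 10 + 4.\<close>
  also have "\<dots> \<le> enat (14 * (T * (core_length D)\<^sup>2))"
    using mult_le_mono2[OF J, of "10 * T"] by (simp add: algebra_simps)
  finally show "ptucker_memory D T rows \<le> enat (14 * (T * (core_length D)\<^sup>2))" .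
qed

end
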